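(* Let $p$ be a prime, let $d, w_1, w_2 \in \mathbb{N}$, let $\chi$ be a Dirichlet character with conductor $d$ (with values in $\mathbb{C}_p$), and let $\xi \in T_p$. For all $n \in \mathbb{Z}_+$, $m \in \mathbb{N}$ and all $x,y\in\mathbb{C}_p$, $$\sum_{k=0}^{n}\binom{n}{k}w_1^{k-1} w_2^{n-k}B_{n-k,\chi,\xi^{w_2}}^{(m-1)}(w_1y)\sum_{i=0}^{w_1d-1}\chi(i)\xi^{w_2 i}B_{k,\chi,\xi^{w_1}}^{(m)}\!\left(w_2x+\frac{w_2}{w_1}i\right)$$ $$=\sum_{k=0}^{n}\binom{n}{k}w_2^{k-1} w_1^{n-k}B_{n-k,\chi,\xi^{w_1}}^{(m-1)}(w_2y)\sum_{i=0}^{w_2d-1}\chi(i)\xi^{w_1 i}B_{k,\chi,\xi^{w_2}}^{(m)}\!\left(w_1x+\frac{w_1}{w_2}i\right).$$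
   Context: $\mathbb{N}=\{1,2,3,\dots\}$ and $\mathbb{Z}_+=\mathbb{N}\cup\{0\}$. $\mathbb{C}_p$ is the completion of an algebraic closure of $\mathbb{Q}_p$. $T_p=\bigcup_{n\ge 1}\{\omega\in\mathbb{C}_p : \omega^{p^n}=1\}$ is the group of $p$-power roots of unity. For $\xi\in T_p$, a Dirichlet character $\chi$ with conductor $d$, and an integer $k\ge 0$, the generalized twisted Bernoulli polynomials of order $k$ attached to $\chi$, $B_{n,\chi,\xi}^{(k)}(x)$, are defined by the identity of formal power series in $t$ $$\left(\frac{t\sum_{a=0}^{d-1}\chi(a)\xi^a e^{at}}{\xi^d e^{dt}-1}\right)^k e^{xt}=\sum_{n=0}^{\infty}B_{n,\chi,\xi}^{(k)}(x)\frac{t^n}{n!}$$ (so for $k=0$ one has $B_{n,\chi,\xi}^{(0)}(x)=x^n$, with $0^0=1$). *)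

theory Defs
  imports "HOL-Analysis.Abstract_Metric_Spaces"
    "HOL-Computational_Algebra.Computational_Algebra"
    "HOL-Number_Theory.Cong"
begin

section \<open>The field of \<open>p\<close>-adic complex numbers\<close>

definition padic_abs_rat :: "nat \<Rightarrow> rat \<Rightarrow> real" where
  "padic_abs_rat p r =
     (if r = 0 then 0
      else real p powi (int (multiplicity (int p) (snd (quotient_of r)))
                        - int (multiplicity (int p) (fst (quotient_of r)))))"

locale ultrametric_field =
  fixes v :: "'a :: field \<Rightarrow> real"
  assumes v_nonneg: "v x \<ge> 0"
    and v_eq_0_iff: "v x = 0 \<longleftrightarrow> x = 0"
    and v_mult: "v (x * y) = v x * v y"
    and v_ultrametric: "v (x + y) \<le> max (v x) (v y)"
begin

lemma v_one: "v 1 = 1"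
  using v_mult[of 1 1] v_eq_0_iff[of 1] by simp

lemma v_minus: "v (- x) = v x"
proof -
  have "v (- 1) * v (- 1) = 1"
    using v_mult[of "- 1" "- 1"] by (simp add: v_one)
  with v_nonneg[of "- 1"] have "v (- 1) = 1"
    by (metis abs_of_nonneg real_sqrt_abs2 real_sqrt_one)
  thus ?thesis
    using v_mult[of "- 1" x] by simp
qed

sublocale Metric_space UNIV "\<lambda>x y. v (x - y)"
proof
  fix x y z :: 'a
  show "v (x - y) = v (y - x)"
    using v_minus[of "x - y"] by simp
  show "v (x - z) \<le> v (x - y) + v (y - z)"
    using v_ultrametric[of "x - y" "y - z"] v_nonneg[of "x - y"] v_nonneg[of "y - z"] by auto
qed (simp_all add: v_nonneg v_eq_0_iff)

end

definition algebraic_over :: "'a :: field set \<Rightarrow> 'a \<Rightarrow> bool" where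
  "algebraic_over F x \<longleftrightarrow> (\<exists>f. f \<noteq> 0 \<and> (\<forall>i. coeff f i \<in> F) \<and> poly f x = 0)"

definition algebraically_closed_set :: "'a :: field set \<Rightarrow> bool" where
  "algebraically_closed_set F \<longleftrightarrow>
     (\<forall>f. degree f > 0 \<and> (\<forall>i. coeff f i \<in> F) \<longrightarrow> (\<exists>x\<in>F. poly f x = 0))"

text \<open>
  \<open>padic_complex p v\<close> says that the type \<open>'a\<close> with absolute value \<open>v\<close> is the completion
  of an algebraic closure of \<open>\<rat>\<^sub>p\<close>, which determines it up to isometric isomorphism.
  In a complete field whose absolute value extends the \<open>p\<close>-adic one on \<open>\<rat>\<close>, the
  closure of \<open>\<rat>\<close> is the \<open>p\<close>-adic completion \<open>\<rat>\<^sub>p\<close>.  The elements algebraic over it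
  always form a subfield, which is an algebraic closure of \<open>\<rat>\<^sub>p\<close> iff it is
  algebraically closed.
\<close>

locale padic_complex = ultrametric_field v
  for p :: nat and v :: "'a :: field_char_0 \<Rightarrow> real" +
  assumes prime_p: "prime p"
    and v_of_rat: "v (of_rat r) = padic_abs_rat p r"
    and complete: "mcomplete"
    and alg_closed: "algebraically_closed_set
                       {x. algebraic_over (mtopology closure_of range of_rat) x}"
    and dense: "mtopology closure_of
                  {x. algebraic_over (mtopology closure_of range of_rat) x} = UNIV"

definition p_power_roots_of_unity :: "nat \<Rightarrow> 'a :: field set" where
  "p_power_roots_of_unity p = {\<omega>. \<exists>n\<ge>1. \<omega> ^ (p ^ n) = 1}"

section \<open>Dirichlet characters\<close>

definition dirichlet_character :: "nat \<Rightarrow> (int \<Rightarrow> 'a :: field) \<Rightarrow> bool" where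
  "dirichlet_character N chi \<longleftrightarrow>
     N > 0 \<and> chi 1 = 1 \<and>
     (\<forall>a b. chi (a * b) = chi a * chi b) \<and>
     (\<forall>a. chi (a + int N) = chi a) \<and>
     (\<forall>a. chi a = 0 \<longleftrightarrow> \<not> coprime a (int N))"

definition conductor :: "nat \<Rightarrow> (int \<Rightarrow> 'a :: field) \<Rightarrow> nat" where
  "conductor N chi =
     (LEAST d. d > 0 \<and> d dvd N \<and>
        (\<forall>a. coprime a (int N) \<and> [a = 1] (mod int d) \<longrightarrow> chi a = 1))"

text \<open>
  As usual for generalized Bernoulli polynomials, a character of conductor \<open>d\<close> is taken
  to be primitive, i.e. defined modulo \<open>d\<close> itself and vanishing exactly at the integers
  not coprime to \<open>d\<close>.
\<close>

definition dirichlet_character_with_conductor :: "nat \<Rightarrow> (int \<Rightarrow> 'a :: field) \<Rightarrow> bool" where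
  "dirichlet_character_with_conductor d chi \<longleftrightarrow> dirichlet_character d chi \<and> conductor d chi = d"

section \<open>Generalized twisted Bernoulli polynomials\<close>

definition twisted_bernoulli_numer ::
  "nat \<Rightarrow> (int \<Rightarrow> 'a :: field_char_0) \<Rightarrow> 'a \<Rightarrow> 'a fps" where
  "twisted_bernoulli_numer d chi \<xi> =
     fps_X * (\<Sum>a<d. fps_const (chi (int a) * \<xi> ^ a) * fps_exp (of_nat a))"

definition twisted_bernoulli_denom :: "nat \<Rightarrow> 'a :: field_char_0 \<Rightarrow> 'a fps" where
  "twisted_bernoulli_denom d \<xi> = fps_const (\<xi> ^ d) * fps_exp (of_nat d) - 1"

text \<open>
  If \<open>\<xi> ^ d = 1\<close>, the denominator has zero constant term and is not a unit, but it then
  has order 1 and divides the numerator; so \<open>div\<close> below is always an exact quotient.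
\<close>

lemma twisted_bernoulli_div_exact:
  fixes \<xi> :: "'a :: field_char_0"
  assumes "d > 0"
  shows "twisted_bernoulli_denom d \<xi> \<noteq> 0"
    and "twisted_bernoulli_numer d chi \<xi> div twisted_bernoulli_denom d \<xi> * twisted_bernoulli_denom d \<xi>
           = twisted_bernoulli_numer d chi \<xi>"
proof -
  let ?N = "twisted_bernoulli_numer d chi \<xi>" and ?D = "twisted_bernoulli_denom d \<xi>"
  have D0: "fps_nth ?D 0 = \<xi> ^ d - 1" and D1: "fps_nth ?D 1 = \<xi> ^ d * of_nat d"
    by (simp_all add: twisted_bernoulli_denom_def)
  have nz: "fps_nth ?D 0 \<noteq> 0 \<or> fps_nth ?D 1 \<noteq> 0"
    using assms unfolding D0 D1 by (auto simp: zero_power)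
  thus D: "?D \<noteq> 0" by auto
  have "?D dvd ?N"
  proof (cases "?N = 0")
    case False
    have "subdegree ?D \<le> 1"
      using nz subdegree_leI[of ?D 0] subdegree_leI[of ?D 1] by auto
    also have "1 \<le> subdegree ?N"
      using False by (intro subdegree_geI) (auto simp: twisted_bernoulli_numer_def)
    finally show ?thesis
      using D False by (simp add: fps_dvd_iff)
  qed simp
  thus "?N div ?D * ?D = ?N" by simp
qed

definition twisted_bernoulli_poly ::
  "nat \<Rightarrow> nat \<Rightarrow> nat \<Rightarrow> (int \<Rightarrow> 'a :: field_char_0) \<Rightarrow> 'a \<Rightarrow> 'a \<Rightarrow> 'a" where
  "twisted_bernoulli_poly d k n chi \<xi> x =
     fact n * fps_nth ((twisted_bernoulli_numer d chi \<xi> div twisted_bernoulli_denom d \<xi>) ^ k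
                         * fps_exp x) n"

end

theory Submission
  imports Defs
begin

text \<open>
  Both sides are coefficients of one power series that is symmetric in \<open>w1\<close> and \<open>w2\<close>.
  Write \<open>Q\<^bsub>w\<^esub>(t)\<close> for the quotient \<open>t \<Sum> chi(a) \<zeta>\<^sup>a e\<^sup>a\<^sup>t / (\<zeta>\<^sup>d e\<^sup>d\<^sup>t - 1)\<close> with
  \<open>\<zeta> = \<xi>\<^sup>w\<close> and \<open>w t\<close> in place of \<open>t\<close>.  Rescaling \<open>t\<close> absorbs the powers of \<open>w1\<close> and \<open>w2\<close>
  on the left-hand side (\<open>scaled_twisted_bernoulli_poly\<close>), and the convolution over \<open>k\<close>
  becomes a product of power series (\<open>binomial_convolution_fps\<close>).  Up to the factor \<open>1 / w1\<close>,
  the left-hand side is therefore \<open>n!\<close> times the \<open>n\<close>-th coefficient of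
  \<open>Q\<^bsub>w1\<^esub>\<^sup>m Q\<^bsub>w2\<^esub>\<^sup>m\<^sup>-\<^sup>1 e\<^bsup>w1 w2 (x + y) t\<^esup> R\<close>, where \<open>R\<close> is the sum of
  \<open>chi(i) \<xi>\<^bsup>w2 i\<^esup> e\<^bsup>w2 i t\<^esup>\<close> over all \<open>i < w1 d\<close>.

  As \<open>chi\<close> has period \<open>d\<close>, a geometric sum (\<open>sum_multiplicative_period\<close>) shows that
  \<open>w2 t R = Q\<^bsub>w2\<^esub> (\<xi>\<^bsup>w1 w2 d\<^esup> e\<^bsup>w1 w2 d t\<^esup> - 1)\<close> (\<open>character_sum_eq_quotient\<close>).  So
  \<open>w1 w2 t\<close> times the generating function of the left-hand side is
  \<open>Q\<^bsub>w1\<^esub>\<^sup>m Q\<^bsub>w2\<^esub>\<^sup>m (\<xi>\<^bsup>w1 w2 d\<^esup> e\<^bsup>w1 w2 d t\<^esup> - 1) e\<^bsup>w1 w2 (x + y) t\<^esup>\<close>.  Exchanging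
  \<open>w1\<close> and \<open>w2\<close> leaves this series unchanged and turns the left-hand side into the
  right-hand side.
\<close>

lemma binomial_convolution_fps:
  fixes F G :: "'a :: field_char_0 fps"
  shows "(\<Sum>k = 0..n. of_nat (n choose k) * (fact (n - k) * fps_nth F (n - k))
            * (fact k * fps_nth G k)) = fact n * fps_nth (F * G) n"
proof -
  have "fact n * fps_nth (F * G) n = (\<Sum>k = 0..n. fact n * (fps_nth G k * fps_nth F (n - k)))"
    by (simp add: mult.commute[of F] fps_mult_nth sum_distrib_left)
  also have "\<dots> = (\<Sum>k = 0..n. of_nat (n choose k) * (fact (n - k) * fps_nth F (n - k))
            * (fact k * fps_nth G k))"
    by (intro sum.cong refl) (simp add: binomial_fact field_simps)
  finally show ?thesis ..
qed

lemma sum_multiplicative_period: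
  fixes f :: "nat \<Rightarrow> 'b :: comm_ring_1"
  assumes period: "\<And>i. f (i + d) = f i * q"
  shows "(\<Sum>i<w * d. f i) * (q - 1) = (\<Sum>i<d. f i) * (q ^ w - 1)"
proof -
  have shift: "f (i + j * d) = f i * q ^ j" for i j
  proof (induction j)
    case (Suc j)
    have "f (i + Suc j * d) = f (i + j * d) * q"
      using period[of "i + j * d"] by (simp add: add_ac)
    thus ?case
      by (simp only: Suc.IH power_Suc2 mult.assoc)
  qed simp
  have "(\<Sum>i<w * d. f i) = (\<Sum>j<w. \<Sum>i = j * d..<j * d + d. f i)"
    by (rule sum.nat_group[symmetric])
  also have "\<dots> = (\<Sum>j<w. \<Sum>i<d. f i * q ^ j)"
  proof (rule sum.cong[OF refl])
    fix j
    show "(\<Sum>i = j * d..<j * d + d. f i) = (\<Sum>i<d. f i * q ^ j)"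
      using sum.shift_bounds_nat_ivl[of f 0 "j * d" d]
      by (simp add: shift atLeast0LessThan add.commute)
  qed
  also have "\<dots> = (\<Sum>i<d. f i) * (\<Sum>j<w. q ^ j)"
    by (simp add: sum_product sum.swap[of _ "{..<w}"])
  finally show ?thesis
    by (simp add: power_diff_1_eq mult_ac)
qed

lemma fps_exp_compose_linear:
  "fps_exp a oo (fps_const c * fps_X) = fps_exp (c * a :: 'a :: field_char_0)"
  by (simp add: fps_eq_iff fps_nth_compose_linear power_mult_distrib)

text \<open>
  The \<open>w\<close>-th quotient \<open>Q\<^bsub>w\<^esub>\<close>: the base of the generating function of the Bernoulli polynomials
  twisted by \<open>\<xi>\<^sup>w\<close>, with the variable multiplied by \<open>w\<close>.
\<close>

definition scaled_quotient :: "nat \<Rightarrow> (int \<Rightarrow> 'a :: field_char_0) \<Rightarrow> 'a \<Rightarrow> nat \<Rightarrow> 'a fps" where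
  "scaled_quotient d chi \<xi> w =
     (twisted_bernoulli_numer d chi (\<xi> ^ w) div twisted_bernoulli_denom d (\<xi> ^ w))
       oo (fps_const (of_nat w) * fps_X)"

lemma scaled_twisted_bernoulli_poly:
  "of_nat w ^ n * twisted_bernoulli_poly d k n chi (\<xi> ^ w) x
     = fact n * fps_nth (scaled_quotient d chi \<xi> w ^ k * fps_exp (of_nat w * x)) n"
proof -
  let ?Q = "twisted_bernoulli_numer d chi (\<xi> ^ w) div twisted_bernoulli_denom d (\<xi> ^ w)"
  have "scaled_quotient d chi \<xi> w ^ k * fps_exp (of_nat w * x)
          = (?Q ^ k * fps_exp x) oo (fps_const (of_nat w) * fps_X)"
    by (simp add: scaled_quotient_def fps_compose_mult_distrib fps_compose_power
        fps_exp_compose_linear)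
  thus ?thesis
    by (simp add: twisted_bernoulli_poly_def fps_nth_compose_linear)
qed

lemma scaled_quotient_times_denom:
  assumes "d > 0"
  shows "scaled_quotient d chi \<xi> w
             * (fps_const (\<xi> ^ (w * d)) * fps_exp (of_nat (w * d)) - 1)
           = fps_const (of_nat w) * fps_X
             * (\<Sum>i<d. fps_const (chi (int i) * \<xi> ^ (w * i)) * fps_exp (of_nat (w * i)))"
proof -
  let ?N = "twisted_bernoulli_numer d chi (\<xi> ^ w)" and ?D = "twisted_bernoulli_denom d (\<xi> ^ w)"
  let ?L = "fps_const (of_nat w) * fps_X :: 'a fps"
  have L0: "fps_nth ?L 0 = 0" by simp
  have "?D oo ?L = fps_const (\<xi> ^ (w * d)) * fps_exp (of_nat (w * d)) - 1"
    by (simp add: twisted_bernoulli_denom_def fps_compose_sub_distrib fps_compose_mult_distrib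
        fps_exp_compose_linear power_mult)
  moreover have "?N oo ?L = ?L
             * (\<Sum>i<d. fps_const (chi (int i) * \<xi> ^ (w * i)) * fps_exp (of_nat (w * i)))"
    by (simp add: twisted_bernoulli_numer_def fps_compose_sum_distrib fps_compose_mult_distrib
        fps_exp_compose_linear power_mult)
  moreover have "(?N div ?D oo ?L) * (?D oo ?L) = ?N oo ?L"
    using twisted_bernoulli_div_exact(2)[OF assms, where chi = chi and \<xi> = "\<xi> ^ w"] L0
    by (metis fps_compose_mult_distrib)
  ultimately show ?thesis
    by (simp add: scaled_quotient_def)
qed

lemma character_sum_eq_quotient:
  assumes "d > 0" and "w > 0"
    and period: "\<And>a. chi (a + int d) = chi a"
  shows "fps_const (of_nat w) * fps_X
             * (\<Sum>i<u * d. fps_const (chi (int i) * \<xi> ^ (w * i)) * fps_exp (of_nat (w * i)))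
           = scaled_quotient d chi \<xi> w
             * (fps_const (\<xi> ^ (u * w * d)) * fps_exp (of_nat (u * w * d)) - 1)"
proof -
  define f where
    "f i = fps_const (chi (int i) * \<xi> ^ (w * i)) * fps_exp (of_nat (w * i))" for i
  define q where "q = fps_const (\<xi> ^ (w * d)) * fps_exp (of_nat (w * d) :: 'a)"
  have f_period: "f (i + d) = f i * q" for i
    by (simp add: f_def q_def period fps_exp_add_mult power_add distrib_left mult_ac
        flip: fps_const_mult)
  have q_power: "q ^ u = fps_const (\<xi> ^ (u * w * d)) * fps_exp (of_nat (u * w * d))"
    by (simp add: q_def power_mult_distrib fps_const_power fps_exp_power_mult mult_ac
        flip: power_mult)
  (* The linear coefficient of q - 1 is \<xi> ^ (w * d) * (w * d); if it vanishes, then q - 1 = - 1. *)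
  have "q - 1 \<noteq> 0"
  proof (cases "\<xi> ^ (w * d) = 0")
    case False
    hence "fps_nth (q - 1) 1 \<noteq> 0"
      using assms by (simp add: q_def)
    thus ?thesis by auto
  qed (use assms in \<open>simp add: q_def zero_power\<close>)
  have "fps_const (of_nat w) * fps_X * (\<Sum>i<u * d. f i) * (q - 1)
          = fps_const (of_nat w) * fps_X * (\<Sum>i<d. f i) * (q ^ u - 1)"
    using sum_multiplicative_period[of f, OF f_period] by (simp add: mult.assoc)
  also have "\<dots> = scaled_quotient d chi \<xi> w * (q ^ u - 1) * (q - 1)"
    using scaled_quotient_times_denom[OF \<open>d > 0\<close>, where chi = chi and \<xi> = \<xi> and w = w]
    by (simp add: f_def q_def mult_ac)
  finally have "fps_const (of_nat w) * fps_X * (\<Sum>i<u * d. f i)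
                  = scaled_quotient d chi \<xi> w * (q ^ u - 1)"
    using \<open>q - 1 \<noteq> 0\<close> by simp
  thus ?thesis
    by (simp only: f_def q_power)
qed

text \<open>
  The right-hand side is symmetric in \<open>w1\<close> and \<open>w2\<close>.  The index \<open>Suc n\<close> accounts for the factor
  \<open>t\<close> by which the generating function of the left-hand side has been multiplied.
\<close>

lemma twisted_bernoulli_convolution_eq_coeff:
  fixes x y \<xi> :: "'a :: field_char_0"
  assumes "d > 0" and "w1 > 0" and "w2 > 0" and "m > 0"
    and period: "\<And>a. chi (a + int d) = chi a"
  shows
    "of_nat (w1 * w2) * (\<Sum>k = 0..n.
        of_nat (n choose k) * of_nat w1 powi (int k - 1) * of_nat w2 ^ (n - k)
          * twisted_bernoulli_poly d (m - 1) (n - k) chi (\<xi> ^ w2) (of_nat w1 * y)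
          * (\<Sum>i = 0..w1 * d - 1.
               chi (int i) * \<xi> ^ (w2 * i)
               * twisted_bernoulli_poly d m k chi (\<xi> ^ w1)
                   (of_nat w2 * x + of_nat w2 / of_nat w1 * of_nat i)))
     = fact n * fps_nth ((scaled_quotient d chi \<xi> w1 * scaled_quotient d chi \<xi> w2) ^ m
         * (fps_const (\<xi> ^ (w1 * w2 * d)) * fps_exp (of_nat (w1 * w2 * d)) - 1)
         * fps_exp (of_nat (w1 * w2) * (x + y))) (Suc n)"
proof -
  let ?Q1 = "scaled_quotient d chi \<xi> w1" and ?Q2 = "scaled_quotient d chi \<xi> w2"
  let ?D = "fps_const (\<xi> ^ (w1 * w2 * d)) * fps_exp (of_nat (w1 * w2 * d)) - 1"
  define R where
    "R = (\<Sum>i<w1 * d. fps_const (chi (int i) * \<xi> ^ (w2 * i)) * fps_exp (of_nat (w2 * i)))"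
  define F where "F = ?Q2 ^ (m - 1) * fps_exp (of_nat w2 * (of_nat w1 * y))"
  define G where "G = ?Q1 ^ m * fps_exp (of_nat (w1 * w2) * x) * R"
  have inner: "of_nat w1 ^ k * (\<Sum>i = 0..w1 * d - 1.
               chi (int i) * \<xi> ^ (w2 * i)
               * twisted_bernoulli_poly d m k chi (\<xi> ^ w1)
                   (of_nat w2 * x + of_nat w2 / of_nat w1 * of_nat i))
             = fact k * fps_nth G k" (is "_ * ?S = _") for k
  proof -
    have "w1 * d > 0"
      using assms by simp
    hence "{0..w1 * d - 1} = {..<w1 * d}"
      by (intro set_eqI) (simp only: atLeastAtMost_iff lessThan_iff, linarith)
    hence "of_nat w1 ^ k * ?S = (\<Sum>i<w1 * d. chi (int i) * \<xi> ^ (w2 * i)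
             * (of_nat w1 ^ k * twisted_bernoulli_poly d m k chi (\<xi> ^ w1)
                   (of_nat w2 * x + of_nat w2 / of_nat w1 * of_nat i)))"
      by (simp add: sum_distrib_left mult_ac)
    also have "\<dots> = (\<Sum>i<w1 * d. fact k * fps_nth (?Q1 ^ m * fps_exp (of_nat (w1 * w2) * x)
             * (fps_const (chi (int i) * \<xi> ^ (w2 * i)) * fps_exp (of_nat (w2 * i)))) k)"
    proof (intro sum.cong refl)
      fix i
      have "of_nat w1 * (of_nat w2 * x + of_nat w2 / of_nat w1 * of_nat i)
              = of_nat (w1 * w2) * x + of_nat (w2 * i)"
        using \<open>w1 > 0\<close> by (simp add: field_simps)
      hence split: "?Q1 ^ m * fps_exp (of_nat (w1 * w2) * x)
               * (fps_const (chi (int i) * \<xi> ^ (w2 * i)) * fps_exp (of_nat (w2 * i)))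
             = fps_const (chi (int i) * \<xi> ^ (w2 * i)) * (?Q1 ^ m
               * fps_exp (of_nat w1 * (of_nat w2 * x + of_nat w2 / of_nat w1 * of_nat i)))"
        by (simp only: fps_exp_add_mult mult_ac)
      show "chi (int i) * \<xi> ^ (w2 * i)
             * (of_nat w1 ^ k * twisted_bernoulli_poly d m k chi (\<xi> ^ w1)
                   (of_nat w2 * x + of_nat w2 / of_nat w1 * of_nat i))
           = fact k * fps_nth (?Q1 ^ m * fps_exp (of_nat (w1 * w2) * x)
               * (fps_const (chi (int i) * \<xi> ^ (w2 * i)) * fps_exp (of_nat (w2 * i)))) k"
        unfolding split fps_mult_left_const_nth scaled_twisted_bernoulli_poly
        by (rule mult.left_commute)
    qed
    also have "\<dots> = fact k * fps_nth G k"
      by (simp only: G_def R_def sum_distrib_left fps_sum_nth)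
    finally show ?thesis .
  qed
  have "of_nat (w1 * w2) * (\<Sum>k = 0..n.
        of_nat (n choose k) * of_nat w1 powi (int k - 1) * of_nat w2 ^ (n - k)
          * twisted_bernoulli_poly d (m - 1) (n - k) chi (\<xi> ^ w2) (of_nat w1 * y)
          * (\<Sum>i = 0..w1 * d - 1.
               chi (int i) * \<xi> ^ (w2 * i)
               * twisted_bernoulli_poly d m k chi (\<xi> ^ w1)
                   (of_nat w2 * x + of_nat w2 / of_nat w1 * of_nat i)))
      = of_nat w2 * (\<Sum>k = 0..n. of_nat (n choose k) * (fact (n - k) * fps_nth F (n - k))
            * (fact k * fps_nth G k))"
    unfolding sum_distrib_left[of "of_nat _"]
  proof (intro sum.cong refl)
    fix k
    have w1_power: "of_nat w1 * of_nat w1 powi (int k - 1) = (of_nat w1 ^ k :: 'a)"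
      using \<open>w1 > 0\<close> by (simp add: power_int_diff)
    have F_coeff: "of_nat w2 ^ (n - k)
          * twisted_bernoulli_poly d (m - 1) (n - k) chi (\<xi> ^ w2) (of_nat w1 * y)
        = fact (n - k) * fps_nth F (n - k)"
      by (simp only: F_def scaled_twisted_bernoulli_poly)
    show "of_nat (w1 * w2) * (of_nat (n choose k) * of_nat w1 powi (int k - 1)
          * of_nat w2 ^ (n - k)
          * twisted_bernoulli_poly d (m - 1) (n - k) chi (\<xi> ^ w2) (of_nat w1 * y)
          * (\<Sum>i = 0..w1 * d - 1.
               chi (int i) * \<xi> ^ (w2 * i)
               * twisted_bernoulli_poly d m k chi (\<xi> ^ w1)
                   (of_nat w2 * x + of_nat w2 / of_nat w1 * of_nat i)))
        = of_nat w2 * (of_nat (n choose k) * (fact (n - k) * fps_nth F (n - k))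
            * (fact k * fps_nth G k))"
      unfolding inner[symmetric] w1_power[symmetric] F_coeff[symmetric] of_nat_mult
      by (simp only: mult_ac)
  qed
  also have "\<dots> = fact n * fps_nth (fps_const (of_nat w2) * fps_X * (F * G)) (Suc n)"
    unfolding binomial_convolution_fps by (simp add: mult.assoc)
  also have "fps_const (of_nat w2) * fps_X * (F * G)
      = (?Q1 * ?Q2) ^ m * ?D * fps_exp (of_nat (w1 * w2) * (x + y))"
  proof -
    have R_eq: "fps_const (of_nat w2) * fps_X * R = ?Q2 * ?D"
      unfolding R_def using assms by (intro character_sum_eq_quotient) auto
    have Q2_power: "?Q2 ^ m = ?Q2 ^ (m - 1) * ?Q2"
      using \<open>m > 0\<close> by (simp add: power_eq_if mult.commute)
    have exp_eq: "fps_exp (of_nat (w1 * w2) * (x + y))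
        = fps_exp (of_nat (w1 * w2) * x) * fps_exp (of_nat w2 * (of_nat w1 * y))"
      by (simp add: distrib_left mult_ac flip: fps_exp_add_mult)
    have "fps_const (of_nat w2) * fps_X * (F * G)
        = ?Q1 ^ m * ?Q2 ^ (m - 1) * (fps_const (of_nat w2) * fps_X * R)
          * (fps_exp (of_nat (w1 * w2) * x) * fps_exp (of_nat w2 * (of_nat w1 * y)))"
      by (simp only: F_def G_def mult_ac)
    also have "\<dots> = (?Q1 * ?Q2) ^ m * ?D * fps_exp (of_nat (w1 * w2) * (x + y))"
      unfolding R_eq exp_eq power_mult_distrib Q2_power by (simp only: mult_ac)
    finally show ?thesis .
  qed
  finally show ?thesis .
qed

theorem theorem3:
  fixes p d w1 w2 n m :: nat
    and v :: "'a :: field_char_0 \<Rightarrow> real"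
    and chi :: "int \<Rightarrow> 'a"
    and \<xi> x y :: 'a
  assumes "prime p"
    and "padic_complex p v"
    and "d \<ge> 1" and "w1 \<ge> 1" and "w2 \<ge> 1" and "m \<ge> 1"
    and "dirichlet_character_with_conductor d chi"
    and "\<xi> \<in> p_power_roots_of_unity p"
  shows
    "(\<Sum>k = 0..n.
        of_nat (n choose k) * of_nat w1 powi (int k - 1) * of_nat w2 ^ (n - k)
          * twisted_bernoulli_poly d (m - 1) (n - k) chi (\<xi> ^ w2) (of_nat w1 * y)
          * (\<Sum>i = 0..w1 * d - 1.
               chi (int i) * \<xi> ^ (w2 * i)
               * twisted_bernoulli_poly d m k chi (\<xi> ^ w1)
                   (of_nat w2 * x + of_nat w2 / of_nat w1 * of_nat i)))
     = (\<Sum>k = 0..n.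
        of_nat (n choose k) * of_nat w2 powi (int k - 1) * of_nat w1 ^ (n - k)
          * twisted_bernoulli_poly d (m - 1) (n - k) chi (\<xi> ^ w1) (of_nat w2 * y)
          * (\<Sum>i = 0..w2 * d - 1.
               chi (int i) * \<xi> ^ (w1 * i)
               * twisted_bernoulli_poly d m k chi (\<xi> ^ w2)
                   (of_nat w1 * x + of_nat w1 / of_nat w2 * of_nat i)))"
proof -
  have period: "chi (a + int d) = chi a" for a
    using assms(7) by (simp add: dirichlet_character_with_conductor_def dirichlet_character_def)
  have pos: "d > 0" "w1 > 0" "w2 > 0" "m > 0"
    using assms by simp_all
  have nonzero: "of_nat (w1 * w2) \<noteq> (0 :: 'a)"
    using pos by simp
  note coeff = twisted_bernoulli_convolution_eq_coeff
    [where n = n and chi = chi and \<xi> = \<xi> and x = x and y = y]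
  note coeff12 = coeff[OF pos period]
  note coeff21 = coeff[OF pos(1,3,2,4) period, unfolded mult.commute[of w2 w1]
      mult.commute[of "scaled_quotient d chi \<xi> w2" "scaled_quotient d chi \<xi> w1"]]
  show ?thesis
    by (rule mult_left_cancel[OF nonzero, THEN iffD1], rule trans[OF coeff12 coeff21[symmetric]])
qed

end
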